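(* Let $K$ be an irreducible Markov kernel on a finite state space $\mathcal{X}$ with $|\mathcal X|\ge2$, with invariant probability measure $\pi$. Suppose that for some constants $C,D,T>0$ the Nash inequality $$\|f\|_2^{2+1/D} \leq C\left[\mathcal E(f,f) + \frac{1}{T}\,\|f\|_2^2\right]\|f\|_1^{1/D}$$ holds for every function $f:\mathcal{X}\to\mathbb R$. Then for all $r\ge\pi_*$ the spectral profile satisfies $$\Lambda(r) \geq \frac{1}{C\,r^{1/(2D)}} - \frac{1}{T}.$$
   Context: $\pi_*=\min_x\pi(x)>0$; $\|\cdot\|_p$ is the $L^p(\pi)$ norm. Dirichlet form: $\mathcal{E}(f,g)=\langle (I-K)f,g\rangle_\pi=\sum_x((I-K)f)(x)g(x)\pi(x)$; $\mathrm{Var}$ is the variance with respect to $\pi$. The spectral profile is $$\Lambda(r)=\inf_{\pi_*\le\pi(S)\le r}\ \inf_{f\in c_0^+(S)}\frac{\mathcal E(f,f)}{\mathrm{Var}(f)},\qquad r\ge\pi_*,$$ where $c_0^+(S)=\{f:\mathcal X\to\mathbb R:\ \mathrm{supp}(f)\subset S,\ f\ge0,\ f\ne\text{constant}\}$. *)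

theory Defs
  imports "HOL-Probability.Probability"
begin

text \<open>The finite state space is a type \<open>'a :: finite\<close>, and a Markov kernel on it is a map
  \<open>K :: 'a \<Rightarrow> 'a pmf\<close>, where \<open>K x\<close> is the distribution of one step from \<open>x\<close>.\<close>

primrec kernel_pow :: "('a \<Rightarrow> 'a pmf) \<Rightarrow> nat \<Rightarrow> 'a \<Rightarrow> 'a pmf" where
  "kernel_pow K 0 = return_pmf"
| "kernel_pow K (Suc n) = (\<lambda>x. bind_pmf (K x) (kernel_pow K n))"

definition irreducible_kernel :: "('a \<Rightarrow> 'a pmf) \<Rightarrow> bool" where
  "irreducible_kernel K \<longleftrightarrow> (\<forall>x y. \<exists>n. pmf (kernel_pow K n x) y > 0)"

definition invariant_measure :: "('a \<Rightarrow> 'a pmf) \<Rightarrow> 'a pmf \<Rightarrow> bool" where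
  "invariant_measure K \<pi> \<longleftrightarrow> bind_pmf \<pi> K = \<pi>"

definition kernel_op :: "('a :: finite \<Rightarrow> 'a pmf) \<Rightarrow> ('a \<Rightarrow> real) \<Rightarrow> 'a \<Rightarrow> real" where
  "kernel_op K f x = (\<Sum>y\<in>UNIV. pmf (K x) y * f y)"

definition inner_pi :: "'a :: finite pmf \<Rightarrow> ('a \<Rightarrow> real) \<Rightarrow> ('a \<Rightarrow> real) \<Rightarrow> real" where
  "inner_pi \<pi> f g = (\<Sum>x\<in>UNIV. f x * g x * pmf \<pi> x)"

definition dirichlet_form ::
    "('a :: finite \<Rightarrow> 'a pmf) \<Rightarrow> 'a pmf \<Rightarrow> ('a \<Rightarrow> real) \<Rightarrow> ('a \<Rightarrow> real) \<Rightarrow> real" where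
  "dirichlet_form K \<pi> f g = inner_pi \<pi> (\<lambda>x. f x - kernel_op K f x) g"

definition Lp_norm :: "real \<Rightarrow> 'a :: finite pmf \<Rightarrow> ('a \<Rightarrow> real) \<Rightarrow> real" where
  "Lp_norm p \<pi> f = (\<Sum>x\<in>UNIV. \<bar>f x\<bar> powr p * pmf \<pi> x) powr (1 / p)"

definition pi_min :: "'a :: finite pmf \<Rightarrow> real" where
  "pi_min \<pi> = Min (range (pmf \<pi>))"

definition c0_plus :: "'a set \<Rightarrow> ('a \<Rightarrow> real) set" where
  "c0_plus S = {f. {x. f x \<noteq> 0} \<subseteq> S \<and> (\<forall>x. f x \<ge> 0) \<and> \<not> f constant_on UNIV}"

text \<open>The infima are real-valued. For an irreducible \<open>K\<close> with invariant \<open>\<pi>\<close>, at least two states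
  and \<open>r \<ge> pi_min \<pi>\<close>, they are genuine: then \<open>\<pi> > 0\<close> everywhere, so every admissible \<open>S\<close> is nonempty
  and \<open>c0_plus S \<noteq> {}\<close>, some singleton is admissible, the variances are positive, and all the
  quotients are bounded below by \<open>0\<close>. For \<open>r < pi_min \<pi>\<close> the value is meaningless.\<close>

definition spectral_profile :: "('a :: finite \<Rightarrow> 'a pmf) \<Rightarrow> 'a pmf \<Rightarrow> real \<Rightarrow> real" where
  "spectral_profile K \<pi> r =
    (INF S \<in> {S. pi_min \<pi> \<le> measure_pmf.prob \<pi> S \<and> measure_pmf.prob \<pi> S \<le> r}.
       INF f \<in> c0_plus S. dirichlet_form K \<pi> f f / measure_pmf.variance \<pi> f)"

end

theory Submission
  imports Defs
begin

text \<open>A function \<open>f\<close> supported in \<open>S\<close> satisfies \<open>\<parallel>f\<parallel>\<^sub>1 \<le> \<pi>(S)\<^sup>1\<^sup>/\<^sup>2 \<parallel>f\<parallel>\<^sub>2\<close> by Cauchy--Schwarz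
  (\<open>L1_norm_le_L2_norm_support\<close>). Substituting this into the Nash inequality puts the factor
  \<open>\<parallel>f\<parallel>\<^sub>2\<^sup>1\<^sup>/\<^sup>D\<close> on both sides; it cancels (\<open>nash_cancel\<close>), and what remains is a lower bound on
  the Rayleigh quotient \<open>\<E>(f,f) / \<parallel>f\<parallel>\<^sub>2\<^sup>2\<close> in terms of \<open>\<pi>(S)\<close> alone, decreasing in \<open>\<pi>(S)\<close>.

  The spectral profile has the variance in the denominator instead of \<open>\<parallel>f\<parallel>\<^sub>2\<^sup>2\<close>. As the variance is
  at most \<open>\<parallel>f\<parallel>\<^sub>2\<^sup>2\<close>, the exchange only increases the quotient, provided that \<open>\<E>(f,f) \<ge> 0\<close>, which
  follows from invariance of \<open>\<pi>\<close> (\<open>dirichlet_form_nonneg\<close>). Irreducibility makes the invariant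
  measure strictly positive (\<open>irreducible_invariant_pos\<close>), so that non-constant functions have
  positive variance and the infima range over nonempty sets.\<close>

section \<open>Invariant measures of irreducible kernels\<close>

lemma bind_kernel_pow_invariant:
  assumes "invariant_measure K \<pi>"
  shows "bind_pmf \<pi> (kernel_pow K n) = \<pi>"
proof (induction n)
  case 0
  show ?case by (simp add: bind_return_pmf')
next
  case (Suc n)
  have "bind_pmf \<pi> (kernel_pow K (Suc n)) = bind_pmf (bind_pmf \<pi> K) (kernel_pow K n)"
    by (simp add: bind_assoc_pmf)
  also have "\<dots> = \<pi>"
    using assms Suc by (simp add: invariant_measure_def)
  finally show ?case .
qed

text \<open>Some state carries mass, and mass at one state is transported to every other state by a
  power of the kernel, which leaves \<open>\<pi>\<close> unchanged.\<close>

lemma irreducible_invariant_pos: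
  assumes "irreducible_kernel K" "invariant_measure K \<pi>"
  shows "pmf \<pi> y > 0"
proof -
  obtain x where x: "x \<in> set_pmf \<pi>"
    using set_pmf_not_empty[of \<pi>] by blast
  obtain n where "pmf (kernel_pow K n x) y > 0"
    using assms(1) unfolding irreducible_kernel_def by blast
  then have "y \<in> set_pmf (kernel_pow K n x)"
    by (simp add: set_pmf_iff)
  with x have "y \<in> set_pmf (bind_pmf \<pi> (kernel_pow K n))"
    by auto
  then have "y \<in> set_pmf \<pi>"
    by (simp only: bind_kernel_pow_invariant[OF assms(2)])
  then show ?thesis
    by (rule pmf_positive)
qed

lemma pi_min_attained: "\<exists>x. pmf \<pi> x = pi_min \<pi>"
proof -
  have "pi_min \<pi> \<in> range (pmf \<pi>)"
    unfolding pi_min_def by (rule Min_in) auto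
  then show ?thesis by auto
qed

lemma invariant_measure_sum:
  fixes K :: "'a :: finite \<Rightarrow> 'a pmf"
  assumes "invariant_measure K \<pi>"
  shows "(\<Sum>x\<in>UNIV. pmf \<pi> x * pmf (K x) y) = pmf \<pi> y"
proof -
  have "pmf \<pi> y = pmf (bind_pmf \<pi> K) y"
    using assms by (simp add: invariant_measure_def)
  also have "\<dots> = (\<Sum>x\<in>UNIV. pmf (K x) y * pmf \<pi> x)"
    unfolding pmf_bind by (rule integral_measure_pmf_real) auto
  finally show ?thesis
    by (simp add: mult.commute)
qed

text \<open>Since \<open>f(x) f(y) \<le> (f(x)\<^sup>2 + f(y)\<^sup>2) / 2\<close>, the form \<open>\<langle>K f, f\<rangle>\<close> is at most the average of the
  second moments of \<open>f\<close> under the two marginals of \<open>\<pi>(x) K(x,y)\<close>. Under invariance both marginals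
  are \<open>\<pi>\<close>.\<close>

lemma dirichlet_form_nonneg:
  fixes K :: "'a :: finite \<Rightarrow> 'a pmf"
  assumes "invariant_measure K \<pi>"
  shows "dirichlet_form K \<pi> f f \<ge> 0"
proof -
  let ?N = "\<Sum>x\<in>UNIV. (f x)\<^sup>2 * pmf \<pi> x"
  let ?w = "\<lambda>x y. pmf \<pi> x * pmf (K x) y"
  have first_marginal: "(\<Sum>x\<in>UNIV. \<Sum>y\<in>UNIV. (f x)\<^sup>2 * ?w x y) = ?N"
  proof (rule sum.cong[OF refl])
    fix x
    have "(\<Sum>y\<in>UNIV. pmf (K x) y) = 1"
      by (rule sum_pmf_eq_1) auto
    then show "(\<Sum>y\<in>UNIV. (f x)\<^sup>2 * ?w x y) = (f x)\<^sup>2 * pmf \<pi> x"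
      by (simp add: sum_distrib_left[symmetric] mult.assoc[symmetric])
  qed
  have "(\<Sum>x\<in>UNIV. \<Sum>y\<in>UNIV. (f y)\<^sup>2 * ?w x y) = (\<Sum>y\<in>UNIV. \<Sum>x\<in>UNIV. (f y)\<^sup>2 * ?w x y)"
    by (rule sum.swap)
  also have "\<dots> = ?N"
    by (simp add: sum_distrib_left[symmetric] invariant_measure_sum[OF assms])
  finally have second_marginal: "(\<Sum>x\<in>UNIV. \<Sum>y\<in>UNIV. (f y)\<^sup>2 * ?w x y) = ?N" .
  have "(\<Sum>x\<in>UNIV. \<Sum>y\<in>UNIV. 2 * (f x * f y) * ?w x y)
      \<le> (\<Sum>x\<in>UNIV. \<Sum>y\<in>UNIV. ((f x)\<^sup>2 + (f y)\<^sup>2) * ?w x y)"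
    using sum_squares_bound by (intro sum_mono mult_right_mono) (auto simp: mult.assoc)
  also have "\<dots> = 2 * ?N"
    using first_marginal second_marginal by (simp add: distrib_right sum.distrib)
  also have "(\<Sum>x\<in>UNIV. \<Sum>y\<in>UNIV. 2 * (f x * f y) * ?w x y)
      = 2 * (\<Sum>x\<in>UNIV. kernel_op K f x * f x * pmf \<pi> x)"
    unfolding kernel_op_def by (simp add: sum_distrib_left sum_distrib_right mult_ac)
  finally show ?thesis
    unfolding dirichlet_form_def inner_pi_def
    by (simp add: left_diff_distrib sum_subtractf power2_eq_square)
qed

section \<open>Norms and variance\<close>

lemma Lp_norm_nonneg: "Lp_norm p \<pi> f \<ge> 0"
  by (simp add: Lp_norm_def)

lemma Lp_norm_1: "Lp_norm 1 \<pi> f = (\<Sum>x\<in>UNIV. \<bar>f x\<bar> * pmf \<pi> x)"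
  by (simp add: Lp_norm_def sum_nonneg)

lemma Lp_norm_2_squared: "(Lp_norm 2 \<pi> f)\<^sup>2 = (\<Sum>x\<in>UNIV. (f x)\<^sup>2 * pmf \<pi> x)"
  by (simp add: Lp_norm_def powr_half_sqrt sum_nonneg)

lemma L1_norm_le_L2_norm_support:
  assumes "{x. f x \<noteq> 0} \<subseteq> S"
  shows "Lp_norm 1 \<pi> f \<le> Lp_norm 2 \<pi> f * sqrt (measure_pmf.prob \<pi> S)"
proof (rule power2_le_imp_le)
  let ?a = "\<lambda>x. \<bar>f x\<bar> * sqrt (pmf \<pi> x)"
  let ?b = "\<lambda>x. indicator S x * sqrt (pmf \<pi> x)"
  have "\<bar>f x\<bar> * pmf \<pi> x = ?a x * ?b x" for x
    using assms by (auto simp: indicator_def)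
  then have "(Lp_norm 1 \<pi> f)\<^sup>2 = (\<Sum>x\<in>UNIV. ?a x * ?b x)\<^sup>2"
    by (simp only: Lp_norm_1)
  also have "\<dots> \<le> (\<Sum>x\<in>UNIV. (?a x)\<^sup>2) * (\<Sum>x\<in>UNIV. (?b x)\<^sup>2)"
    by (rule Cauchy_Schwarz_ineq_sum)
  also have "(\<Sum>x\<in>UNIV. (?a x)\<^sup>2) = (Lp_norm 2 \<pi> f)\<^sup>2"
    by (simp add: Lp_norm_2_squared power_mult_distrib)
  also have "(\<Sum>x\<in>UNIV. (?b x)\<^sup>2) = (\<Sum>x\<in>UNIV. if x \<in> S then pmf \<pi> x else 0)"
    by (rule sum.cong) (auto simp: indicator_def)
  also have "\<dots> = measure_pmf.prob \<pi> S"
    by (simp add: measure_measure_pmf_finite sum.If_cases)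
  finally show "(Lp_norm 1 \<pi> f)\<^sup>2 \<le> (Lp_norm 2 \<pi> f * sqrt (measure_pmf.prob \<pi> S))\<^sup>2"
    by (simp add: power_mult_distrib)
qed (simp add: Lp_norm_nonneg)

lemma variance_le_L2_norm_squared:
  fixes \<pi> :: "'a :: finite pmf"
  shows "measure_pmf.variance \<pi> f \<le> (Lp_norm 2 \<pi> f)\<^sup>2"
proof -
  have "measure_pmf.variance \<pi> f
      = measure_pmf.expectation \<pi> (\<lambda>x. (f x)\<^sup>2) - (measure_pmf.expectation \<pi> f)\<^sup>2"
    by (rule measure_pmf.variance_eq) (simp_all add: integrable_measure_pmf_finite)
  also have "\<dots> \<le> measure_pmf.expectation \<pi> (\<lambda>x. (f x)\<^sup>2)"
    by simp
  also have "\<dots> = (Lp_norm 2 \<pi> f)\<^sup>2"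
    unfolding Lp_norm_2_squared by (rule integral_measure_pmf_real) auto
  finally show ?thesis .
qed

lemma variance_pos:
  fixes \<pi> :: "'a :: finite pmf" and f :: "'a \<Rightarrow> real"
  assumes pos: "\<And>x. pmf \<pi> x > 0" and "\<not> f constant_on UNIV"
  shows "measure_pmf.variance \<pi> f > 0"
proof -
  let ?m = "measure_pmf.expectation \<pi> f"
  obtain x where "f x \<noteq> ?m"
    using assms(2) unfolding constant_on_def by blast
  then have "0 < (\<Sum>x\<in>UNIV. (f x - ?m)\<^sup>2 * pmf \<pi> x)"
    using pos by (intro sum_pos2[of _ x]) auto
  also have "\<dots> = measure_pmf.variance \<pi> f"
    by (rule integral_measure_pmf_real[symmetric]) auto
  finally show ?thesis .
qed

lemma c0_plus_nonempty:
  fixes S :: "'a :: finite set"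
  assumes "CARD('a) \<ge> 2" "x \<in> S"
  shows "c0_plus S \<noteq> {}"
proof -
  obtain y where "y \<noteq> x"
  proof -
    have "(UNIV :: 'a set) \<noteq> {x}"
      using assms(1) by (metis card.empty card.insert empty_iff finite.emptyI
          not_less_eq_eq numeral_2_eq_2 order_refl)
    then show thesis
      using that by blast
  qed
  then have "\<not> (indicator {x} :: 'a \<Rightarrow> real) constant_on UNIV"
    unfolding constant_on_def by (metis UNIV_I indicator_simps(1,2) singleton_iff zero_neq_one)
  then have "(indicator {x} :: 'a \<Rightarrow> real) \<in> c0_plus S"
    using assms(2) by (auto simp: c0_plus_def indicator_def)
  then show ?thesis by blast
qed

section \<open>The profile bound\<close>

text \<open>Here \<open>N\<close> and \<open>M\<close> are the \<open>L\<^sup>2\<close> and \<open>L\<^sup>1\<close> norms of a function and \<open>B\<close> is the bracket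
  \<open>\<E>(f,f) + \<parallel>f\<parallel>\<^sub>2\<^sup>2 / T\<close>. The power \<open>N\<^sup>1\<^sup>/\<^sup>D\<close> cancels from the Nash inequality once \<open>M\<close> is bounded
  by \<open>N\<close> times the square root of a bound \<open>r\<close> on the mass of the support.\<close>

lemma nash_cancel:
  fixes N M B C D r :: real
  assumes nash: "N powr (2 + 1 / D) \<le> C * B * M powr (1 / D)"
    and "0 \<le> M" and M: "M \<le> N * sqrt r"
    and "0 < N" "0 \<le> B" "0 < C" "0 < D" "0 < r"
  shows "N\<^sup>2 \<le> C * r powr (1 / (2 * D)) * B"
proof -
  have "N\<^sup>2 * N powr (1 / D) = N powr (2 + 1 / D)"
    using \<open>0 < N\<close> by (simp add: powr_add)
  also have "\<dots> \<le> C * B * (N * sqrt r) powr (1 / D)"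
    using assms by (intro order_trans[OF nash] mult_left_mono powr_mono2) auto
  also have "\<dots> = (C * r powr (1 / (2 * D)) * B) * N powr (1 / D)"
    using assms by (simp add: powr_mult powr_half_sqrt[symmetric] powr_powr)
  finally show ?thesis
    using \<open>0 < N\<close> by (simp add: mult_le_cancel_right)
qed

theorem lemma4p3:
  fixes K :: "'a :: finite \<Rightarrow> 'a pmf" and \<pi> :: "'a pmf" and C D T r :: real
  assumes "CARD('a) \<ge> 2"
    and "irreducible_kernel K"
    and "invariant_measure K \<pi>"
    and "C > 0" and "D > 0" and "T > 0"
    and nash: "\<And>f :: 'a \<Rightarrow> real.
      Lp_norm 2 \<pi> f powr (2 + 1 / D)
        \<le> C * (dirichlet_form K \<pi> f f + 1 / T * (Lp_norm 2 \<pi> f)\<^sup>2) * Lp_norm 1 \<pi> f powr (1 / D)"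
    and "r \<ge> pi_min \<pi>"
  shows "spectral_profile K \<pi> r \<ge> 1 / (C * r powr (1 / (2 * D))) - 1 / T"
proof -
  have pos: "pmf \<pi> x > 0" for x
    using irreducible_invariant_pos assms(2,3) by metis
  obtain x0 where x0: "pmf \<pi> x0 = pi_min \<pi>"
    using pi_min_attained by blast
  have "pi_min \<pi> > 0"
    using pos[of x0] x0 by simp
  then have "r > 0"
    using \<open>r \<ge> pi_min \<pi>\<close> by simp
  define A where "A = C * r powr (1 / (2 * D))"
  have "A > 0"
    using \<open>C > 0\<close> \<open>r > 0\<close> by (simp add: A_def)
  have quotient: "1 / A - 1 / T \<le> dirichlet_form K \<pi> f f / measure_pmf.variance \<pi> f"
    if S: "measure_pmf.prob \<pi> S \<le> r" and f: "f \<in> c0_plus S" for S f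
  proof -
    let ?E = "dirichlet_form K \<pi> f f" and ?N = "Lp_norm 2 \<pi> f"
    have E: "?E \<ge> 0"
      using dirichlet_form_nonneg assms(3) .
    have V: "measure_pmf.variance \<pi> f > 0"
      using f pos by (intro variance_pos) (auto simp: c0_plus_def)
    have V_le: "measure_pmf.variance \<pi> f \<le> ?N\<^sup>2"
      by (rule variance_le_L2_norm_squared)
    have "?N\<^sup>2 > 0"
      using V V_le by linarith
    then have N: "?N > 0"
      using Lp_norm_nonneg[of 2 \<pi> f] by (simp add: less_le)
    have "Lp_norm 1 \<pi> f \<le> ?N * sqrt (measure_pmf.prob \<pi> S)"
      using f by (intro L1_norm_le_L2_norm_support) (auto simp: c0_plus_def)
    also have "\<dots> \<le> ?N * sqrt r"
      using S N by simp
    finally have "?N\<^sup>2 \<le> A * (?E + 1 / T * ?N\<^sup>2)"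
      unfolding A_def using E N \<open>r > 0\<close> assms(4-6)
      by (intro nash_cancel[OF nash]) (auto simp: Lp_norm_nonneg)
    then have "?N\<^sup>2 / A \<le> ?E + 1 / T * ?N\<^sup>2"
      using \<open>A > 0\<close> by (simp add: pos_divide_le_eq mult.commute)
    then have "(1 / A - 1 / T) * ?N\<^sup>2 \<le> ?E"
      by (simp add: left_diff_distrib)
    then have "1 / A - 1 / T \<le> ?E / ?N\<^sup>2"
      using \<open>?N\<^sup>2 > 0\<close> by (simp add: pos_le_divide_eq)
    also have "\<dots> \<le> ?E / measure_pmf.variance \<pi> f"
      using E V V_le \<open>?N\<^sup>2 > 0\<close> by (intro divide_left_mono mult_pos_pos)
    finally show ?thesis .
  qed
  show ?thesis
    unfolding spectral_profile_def A_def[symmetric]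
  proof (intro cINF_greatest)
    have "{x0} \<in> {S. pi_min \<pi> \<le> measure_pmf.prob \<pi> S \<and> measure_pmf.prob \<pi> S \<le> r}"
      using x0 \<open>r \<ge> pi_min \<pi>\<close> by (simp add: measure_pmf_single)
    then show "{S. pi_min \<pi> \<le> measure_pmf.prob \<pi> S \<and> measure_pmf.prob \<pi> S \<le> r} \<noteq> {}"
      by blast
  next
    fix S
    assume S: "S \<in> {S. pi_min \<pi> \<le> measure_pmf.prob \<pi> S \<and> measure_pmf.prob \<pi> S \<le> r}"
    then have "S \<noteq> {}"
      using \<open>pi_min \<pi> > 0\<close> by auto
    then show "c0_plus S \<noteq> {}"
      using c0_plus_nonempty[OF \<open>CARD('a) \<ge> 2\<close>] by blast
  qed (use quotient in auto)
qed

end
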